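(* Let $W$ be a finite Coxeter group and $M(W)$ its biHecke monoid. The elements $f$ of $M(W)$ preserve left order: for all $u,v\in W$, $u\le_L v$ implies $u.f\le_L v.f$.
   Context: $W$ is a finite Coxeter group with simple reflections $(s_i)_{i\in I}$ and length $\ell$; $D_R(w)=\{i:\ell(ws_i)<\ell(w)\}$. The biHecke monoid $M(W)$ is the monoid of functions $W\to W$, acting on the right, generated by $\pi_i,\overline\pi_i$ ($i\in I$), where $w.\pi_i=w$ if $i\in D_R(w)$ and $ws_i$ otherwise; $w.\overline\pi_i=ws_i$ if $i\in D_R(w)$ and $w$ otherwise. Left (weak) order: $u\le_L v$ if some reduced word of $u$ is a right factor (suffix) of some reduced word of $v$. *)

theory Defs
  imports "HOL-Algebra.Group" "HOL-Library.Sublist"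
begin

definition word_prod :: "('a, 'b) monoid_scheme \<Rightarrow> ('i \<Rightarrow> 'a) \<Rightarrow> 'i list \<Rightarrow> 'a" where
  "word_prod G s xs = foldr (\<otimes>\<^bsub>G\<^esub>) (map s xs) \<one>\<^bsub>G\<^esub>"

text \<open>Deletion of one Coxeter relator \<open>(s\<^sub>i s\<^sub>j)^m(i,j)\<close> in a word over \<open>I\<close>. The
  value \<open>m i j = 0\<close> encodes \<open>m(i,j) = \<infinity>\<close>, that is, no relation.\<close>

inductive relator_step :: "'i set \<Rightarrow> ('i \<Rightarrow> 'i \<Rightarrow> nat) \<Rightarrow> 'i list \<Rightarrow> 'i list \<Rightarrow> bool"
  for I m where
  "\<lbrakk>xs \<in> lists I; ys \<in> lists I; i \<in> I; j \<in> I; m i j \<noteq> 0\<rbrakk>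
    \<Longrightarrow> relator_step I m (xs @ concat (replicate (m i j) [i, j]) @ ys) (xs @ ys)"

text \<open>The group \<open>G\<close> with simple reflections \<open>s i\<close> (\<open>i \<in> I\<close>) is presented by the generators
  \<open>s i\<close> and the relators \<open>(s\<^sub>i s\<^sub>j)^m(i,j)\<close>. As \<open>m i i = 1\<close>, the relators include \<open>s\<^sub>i s\<^sub>i\<close>, so
  inverses of generators are not needed: the presentation says that the words over \<open>I\<close> represent
  all of \<open>G\<close>, and that two words represent the same element iff they are congruent modulo the
  relators.\<close>

locale coxeter_system = group G
  for G :: "('a, 'b) monoid_scheme" (structure) +
  fixes I :: "'i set" and s :: "'i \<Rightarrow> 'a" and m :: "'i \<Rightarrow> 'i \<Rightarrow> nat"
  assumes coxeter_matrix_diag: "i \<in> I \<Longrightarrow> m i i = 1"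
    and coxeter_matrix_off_diag: "\<lbrakk>i \<in> I; j \<in> I; i \<noteq> j\<rbrakk> \<Longrightarrow> m i j \<noteq> 1"
    and coxeter_matrix_sym: "\<lbrakk>i \<in> I; j \<in> I\<rbrakk> \<Longrightarrow> m i j = m j i"
    and generators_closed: "i \<in> I \<Longrightarrow> s i \<in> carrier G"
    and generated: "w \<in> carrier G \<Longrightarrow> \<exists>xs \<in> lists I. word_prod G s xs = w"
    and presented: "\<lbrakk>xs \<in> lists I; ys \<in> lists I\<rbrakk>
      \<Longrightarrow> word_prod G s xs = word_prod G s ys \<longleftrightarrow> equivclp (relator_step I m) xs ys"

definition cox_length :: "('a, 'b) monoid_scheme \<Rightarrow> 'i set \<Rightarrow> ('i \<Rightarrow> 'a) \<Rightarrow> 'a \<Rightarrow> nat" where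
  "cox_length G I s w = (LEAST n. \<exists>xs \<in> lists I. word_prod G s xs = w \<and> length xs = n)"

definition reduced_word ::
  "('a, 'b) monoid_scheme \<Rightarrow> 'i set \<Rightarrow> ('i \<Rightarrow> 'a) \<Rightarrow> 'a \<Rightarrow> 'i list \<Rightarrow> bool" where
  "reduced_word G I s w xs \<longleftrightarrow>
    xs \<in> lists I \<and> word_prod G s xs = w \<and> length xs = cox_length G I s w"

definition left_order :: "('a, 'b) monoid_scheme \<Rightarrow> 'i set \<Rightarrow> ('i \<Rightarrow> 'a) \<Rightarrow> 'a \<Rightarrow> 'a \<Rightarrow> bool" where
  "left_order G I s u v \<longleftrightarrow>
    (\<exists>xs ys. reduced_word G I s u xs \<and> reduced_word G I s v ys \<and> suffix xs ys)"

definition right_descents ::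
  "('a, 'b) monoid_scheme \<Rightarrow> 'i set \<Rightarrow> ('i \<Rightarrow> 'a) \<Rightarrow> 'a \<Rightarrow> 'i set" where
  "right_descents G I s w =
    {i \<in> I. cox_length G I s (w \<otimes>\<^bsub>G\<^esub> s i) < cox_length G I s w}"

definition hecke_pi ::
  "('a, 'b) monoid_scheme \<Rightarrow> 'i set \<Rightarrow> ('i \<Rightarrow> 'a) \<Rightarrow> 'i \<Rightarrow> 'a \<Rightarrow> 'a" where
  "hecke_pi G I s i =
    (\<lambda>w \<in> carrier G. if i \<in> right_descents G I s w then w else w \<otimes>\<^bsub>G\<^esub> s i)"

definition hecke_pi_bar ::
  "('a, 'b) monoid_scheme \<Rightarrow> 'i set \<Rightarrow> ('i \<Rightarrow> 'a) \<Rightarrow> 'i \<Rightarrow> 'a \<Rightarrow> 'a" where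
  "hecke_pi_bar G I s i =
    (\<lambda>w \<in> carrier G. if i \<in> right_descents G I s w then w \<otimes>\<^bsub>G\<^esub> s i else w)"

text \<open>Functions on the carrier are extensional functions. They act on the right, so
  the product \<open>f g\<close> in the monoid is first \<open>f\<close>, then \<open>g\<close>, and \<open>w.f\<close> is written \<open>f w\<close>.\<close>

inductive_set biHecke_monoid :: "('a, 'b) monoid_scheme \<Rightarrow> 'i set \<Rightarrow> ('i \<Rightarrow> 'a) \<Rightarrow> ('a \<Rightarrow> 'a) set"
  for G :: "('a, 'b) monoid_scheme" and I :: "'i set" and s :: "'i \<Rightarrow> 'a" where
  one: "(\<lambda>w \<in> carrier G. w) \<in> biHecke_monoid G I s"
| pi: "i \<in> I \<Longrightarrow> hecke_pi G I s i \<in> biHecke_monoid G I s"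
| pi_bar: "i \<in> I \<Longrightarrow> hecke_pi_bar G I s i \<in> biHecke_monoid G I s"
| mult: "\<lbrakk>f \<in> biHecke_monoid G I s; g \<in> biHecke_monoid G I s\<rbrakk>
    \<Longrightarrow> compose (carrier G) g f \<in> biHecke_monoid G I s"

end

theory Submission
  imports Defs
begin

text \<open>
  Write \<open>\<ell>\<close> for the length. Left order is \<open>u \<le>\<^sub>L v\<close> iff \<open>v = x u\<close> for some \<open>x\<close> with
  \<open>\<ell>(v) = \<ell>(x) + \<ell>(u)\<close> (\<open>left_order_iff_length_add\<close>), and it suffices to treat the generators
  \<open>\<pi>\<^sub>i\<close> and \<open>\<pi>\<^sub>i\<close>-bar. Each of them moves an element \<open>w\<close> to \<open>w\<close> or to \<open>w s\<^sub>i\<close>, depending on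
  whether \<open>i\<close> is a descent of \<open>w\<close>, and descents of \<open>u\<close> are descents of \<open>v\<close>. If \<open>i\<close> is a
  descent of both or of neither, then the same \<open>x\<close> still works, because multiplication by \<open>s\<^sub>i\<close>
  shifts the lengths of \<open>u\<close> and \<open>v\<close> by the same amount. The remaining case is that \<open>i\<close> is a
  descent of \<open>v\<close> but not of \<open>u\<close>. Then the exchange condition removes a letter from a reduced word
  of \<open>v\<close>, and this letter cannot lie in the part that spells \<open>u\<close>; so \<open>v s\<^sub>i = x' u\<close> with
  \<open>\<ell>(x') = \<ell>(x) - 1\<close> (\<open>exchange_left_factor\<close>). This one equation gives both
  \<open>u \<le>\<^sub>L v s\<^sub>i\<close> and \<open>u s\<^sub>i \<le>\<^sub>L v\<close>.

  The exchange condition has to be extracted from the presentation. To a word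
  \<open>i\<^sub>1 \<dots> i\<^sub>n\<close> belong the reflections \<open>t\<^sub>k = (s\<^sub>n \<dots> s\<^sub>k\<^sub>+\<^sub>1) s\<^sub>k (s\<^sub>k\<^sub>+\<^sub>1 \<dots> s\<^sub>n)\<close>;
  multiplying the word by \<open>t\<^sub>k\<close> on the right deletes its \<open>k\<close>-th letter. The parity of the
  number of \<open>k\<close> with \<open>t\<^sub>k = t\<close> does not change when a relator is deleted, since the list of
  reflections of a relator is some list repeated twice. Hence this parity depends only on the
  element that the word represents. For \<open>t = s\<^sub>i\<close> it differs between \<open>w\<close> and \<open>w s\<^sub>i\<close>, so
  exactly one of these two elements becomes shorter under \<open>s\<^sub>i\<close>, by deletion of a letter.
\<close>

context coxeter_system
begin

section \<open>Words and length\<close>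

abbreviation P :: "'i list \<Rightarrow> 'a" where
  "P \<equiv> word_prod G s"

abbreviation len :: "'a \<Rightarrow> nat" where
  "len \<equiv> cox_length G I s"

lemma word_prod_Nil [simp]: "P [] = \<one>"
  by (simp add: word_prod_def)

lemma word_prod_Cons [simp]: "P (i # xs) = s i \<otimes> P xs"
  by (simp add: word_prod_def)

lemma word_prod_closed [simp]: "xs \<in> lists I \<Longrightarrow> P xs \<in> carrier G"
  by (induction xs) (auto simp: generators_closed)

lemma word_prod_append:
  "xs \<in> lists I \<Longrightarrow> ys \<in> lists I \<Longrightarrow> P (xs @ ys) = P xs \<otimes> P ys"
  by (induction xs) (auto simp: generators_closed m_assoc)

lemma len_le: "xs \<in> lists I \<Longrightarrow> len (P xs) \<le> length xs"
  unfolding cox_length_def by (rule Least_le) auto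

lemma reduced_word_exists:
  assumes "w \<in> carrier G"
  obtains xs where "xs \<in> lists I" "P xs = w" "length xs = len w"
proof -
  have "\<exists>n. \<exists>xs \<in> lists I. P xs = w \<and> length xs = n"
    using generated[OF assms] by blast
  from LeastI_ex[OF this] show thesis
    using that unfolding cox_length_def by blast
qed

lemma len_mult_le:
  assumes "x \<in> carrier G" "y \<in> carrier G"
  shows "len (x \<otimes> y) \<le> len x + len y"
proof -
  obtain xs where "xs \<in> lists I" "P xs = x" "length xs = len x"
    using reduced_word_exists[OF assms(1)] .
  moreover obtain ys where "ys \<in> lists I" "P ys = y" "length ys = len y"
    using reduced_word_exists[OF assms(2)] .
  ultimately show ?thesis
    using len_le[of "xs @ ys"] by (simp add: word_prod_append)
qed

lemma len_generator_le: "i \<in> I \<Longrightarrow> len (s i) \<le> 1"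
  using len_le[of "[i]"] by (simp add: generators_closed)

lemma left_order_iff_length_add:
  assumes "u \<in> carrier G" "v \<in> carrier G"
  shows "left_order G I s u v \<longleftrightarrow> (\<exists>x \<in> carrier G. v = x \<otimes> u \<and> len v = len x + len u)"
proof
  assume "left_order G I s u v"
  then obtain zs xs where "reduced_word G I s u xs" "reduced_word G I s v (zs @ xs)"
    unfolding left_order_def suffix_def by blast
  then have zs: "zs \<in> lists I" and xs: "xs \<in> lists I" "P xs = u" "length xs = len u"
    and v: "P (zs @ xs) = v" "length (zs @ xs) = len v"
    by (auto simp: reduced_word_def)
  have "v = P zs \<otimes> u"
    using v(1) zs xs by (simp add: word_prod_append)
  moreover from this have "len v = len (P zs) + len u"
    using v(2) xs(3) len_le[OF zs] len_mult_le[OF word_prod_closed[OF zs] assms(1)] by simp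
  ultimately show "\<exists>x \<in> carrier G. v = x \<otimes> u \<and> len v = len x + len u"
    using word_prod_closed[OF zs] by blast
next
  assume "\<exists>x \<in> carrier G. v = x \<otimes> u \<and> len v = len x + len u"
  then obtain x where x: "x \<in> carrier G" "v = x \<otimes> u" "len v = len x + len u"
    by blast
  obtain xs where xs: "xs \<in> lists I" "P xs = x" "length xs = len x"
    using reduced_word_exists[OF x(1)] .
  obtain ys where ys: "ys \<in> lists I" "P ys = u" "length ys = len u"
    using reduced_word_exists[OF assms(1)] .
  have "reduced_word G I s u ys" "reduced_word G I s v (xs @ ys)"
    using xs ys x by (auto simp: reduced_word_def word_prod_append)
  then show "left_order G I s u v"
    unfolding left_order_def by (blast intro: suffixI)
qed

lemma alternating_word_closed:
  "i \<in> I \<Longrightarrow> j \<in> I \<Longrightarrow> concat (replicate n [i, j]) \<in> lists I"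
  by (induction n) auto

lemma relator_eq_one:
  assumes "i \<in> I" "j \<in> I" "m i j \<noteq> 0"
  shows "P (concat (replicate (m i j) [i, j])) = \<one>"
proof -
  have "relator_step I m ([] @ concat (replicate (m i j) [i, j]) @ []) ([] @ [])"
    using assms by (intro relator_step.intros) auto
  then have "equivclp (relator_step I m) (concat (replicate (m i j) [i, j])) []"
    by (simp add: r_into_equivclp)
  moreover have "concat (replicate (m i j) [i, j]) \<in> lists I"
    using assms by (simp only: alternating_word_closed)
  ultimately show ?thesis
    using presented[of "concat (replicate (m i j) [i, j])" "[]"] by simp
qed

lemma generator_square: "i \<in> I \<Longrightarrow> s i \<otimes> s i = \<one>"
  using relator_eq_one[of i i] coxeter_matrix_diag[of i] by (simp add: generators_closed)

lemma mult_generator_twice: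
  "i \<in> I \<Longrightarrow> w \<in> carrier G \<Longrightarrow> w \<otimes> s i \<otimes> s i = w"
  by (simp add: m_assoc generators_closed generator_square)

lemma inv_generator: "i \<in> I \<Longrightarrow> inv (s i) = s i"
  by (simp add: inv_equality generators_closed generator_square)

lemma mult_inv_mult: "a \<in> carrier G \<Longrightarrow> b \<in> carrier G \<Longrightarrow> a \<otimes> (inv a \<otimes> b) = b"
  by (simp flip: m_assoc)

section \<open>Reflections of a word\<close>

primrec refls :: "'i list \<Rightarrow> 'a list" where
  "refls [] = []"
| "refls (i # xs) = (inv (P xs) \<otimes> s i \<otimes> P xs) # refls xs"

lemma refls_closed: "xs \<in> lists I \<Longrightarrow> set (refls xs) \<subseteq> carrier G"
  by (induction xs) (auto simp: generators_closed)

lemma refls_append: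
  assumes "xs \<in> lists I" "ys \<in> lists I"
  shows "refls (xs @ ys) = map (\<lambda>t. inv (P ys) \<otimes> t \<otimes> P ys) (refls xs) @ refls ys"
  using assms
  by (induction xs) (auto simp: word_prod_append inv_mult_group m_assoc generators_closed)

lemma mult_refl_deletes_letter:
  assumes "xs \<in> lists I" "t \<in> set (refls xs)"
  shows "\<exists>ys \<in> lists I. length ys < length xs \<and> P xs \<otimes> t = P ys"
  using assms
proof (induction rule: lists.induct)
  case (Cons i xs)
  note i = Cons.hyps(1) and xs = Cons.hyps(2)
  note closed = generators_closed[OF i] word_prod_closed[OF xs]
  show ?case
  proof (cases "t \<in> set (refls xs)")
    case True
    then obtain ys where ys: "ys \<in> lists I" "length ys < length xs" "P xs \<otimes> t = P ys"
      using Cons.IH by blast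
    moreover have "t \<in> carrier G" using True refls_closed[OF xs] by blast
    ultimately show ?thesis
      using i closed by (intro bexI[of _ "i # ys"]) (auto simp: m_assoc)
  next
    case False
    then have t: "t = inv (P xs) \<otimes> s i \<otimes> P xs" using Cons.prems by simp
    have "P (i # xs) \<otimes> t = s i \<otimes> (P xs \<otimes> inv (P xs)) \<otimes> s i \<otimes> P xs"
      unfolding t using closed by (simp add: m_assoc mult_inv_mult)
    also have "\<dots> = P xs"
      using closed i by (simp add: generator_square)
    finally show ?thesis
      using xs by (intro bexI[of _ xs]) auto
  qed
qed simp

text \<open>
  The word \<open>i j \<dots> i j\<close> has dihedral reflections: read from its right end they are
  \<open>s\<^sub>j, q s\<^sub>j, q\<^sup>2 s\<^sub>j, \<dots>\<close> for the rotation \<open>q = s\<^sub>j s\<^sub>i\<close>, because \<open>s\<^sub>j\<close> conjugates \<open>q\<close> to its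
  inverse.
\<close>

lemma refls_alternating:
  assumes i: "i \<in> I" and j: "j \<in> I"
  shows "refls (concat (replicate n [i, j])) =
    map (\<lambda>k. (s j \<otimes> s i) [^] k \<otimes> s j) (rev [0..<2 * n])"
proof (induction n)
  case (Suc n)
  \<comment> \<open>Split off the last two letters: they conjugate the earlier reflections, which shifts the
    exponents by two.\<close>
  let ?q = "s j \<otimes> s i"
  note closed = generators_closed[OF i] generators_closed[OF j]
  have word: "concat (replicate (Suc n) [i, j]) = concat (replicate n [i, j]) @ [i, j]"
    by (simp flip: replicate_append_same)
  have lists: "concat (replicate n [i, j]) \<in> lists I" "[i, j] \<in> lists I"
    using alternating_word_closed[OF i j] i j by auto
  have conj: "inv (P [i, j]) \<otimes> (?q [^] k \<otimes> s j) \<otimes> P [i, j] = ?q [^] (k + 2) \<otimes> s j" for k :: nat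
  proof -
    have "inv (P [i, j]) \<otimes> (?q [^] k \<otimes> s j) \<otimes> P [i, j] = (?q \<otimes> ?q [^] k) \<otimes> ?q \<otimes> s j"
      using closed i j by (simp add: inv_mult_group inv_generator m_assoc)
    also have "?q \<otimes> ?q [^] k = ?q [^] Suc k"
      using closed nat_pow_Suc2 m_closed by simp
    finally show ?thesis by simp
  qed
  have last: "refls [i, j] = [?q \<otimes> s j, s j]"
    using closed j by (simp add: inv_generator)
  have "map (\<lambda>t. inv (P [i, j]) \<otimes> t \<otimes> P [i, j]) (map (\<lambda>k. ?q [^] k \<otimes> s j) (rev [0..<2 * n]))
      = map (\<lambda>k. ?q [^] k \<otimes> s j) (rev (map (\<lambda>k. k + 2) [0..<2 * n]))"
    unfolding map_map comp_def conj by (simp add: rev_map comp_def)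
  also have "map (\<lambda>k. k + 2) [0..<2 * n] = [2..<2 * Suc n]"
    by (simp only: map_add_upt) simp
  finally have "refls (concat (replicate (Suc n) [i, j]))
      = map (\<lambda>k. ?q [^] k \<otimes> s j) (rev [2..<2 * Suc n]) @ [?q \<otimes> s j, s j]"
    unfolding word refls_append[OF lists] Suc.IH last by simp
  moreover have "[0..<2 * Suc n] = [0, 1] @ [2..<2 * Suc n]"
    by (simp add: upt_rec numeral_2_eq_2)
  ultimately show ?case
    using closed by simp
qed simp

text \<open>
  In a relator the exponents of \<open>q\<close> run from \<open>0\<close> to \<open>2 m - 1\<close>, and \<open>q\<^sup>m = 1\<close>.
\<close>

lemma refls_relator_doubled:
  assumes i: "i \<in> I" and j: "j \<in> I" and m: "m i j \<noteq> 0"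
  obtains L where "refls (concat (replicate (m i j) [i, j])) = L @ L"
proof -
  let ?q = "s j \<otimes> s i" and ?n = "m i j"
  note closed = generators_closed[OF i] generators_closed[OF j]
  let ?f = "\<lambda>k::nat. ?q [^] k \<otimes> s j"
  have pow: "P (concat (replicate n [i, j])) = (s i \<otimes> s j) [^] n" for n
  proof (induction n)
    case (Suc n)
    then have "P (concat (replicate (Suc n) [i, j])) = (s i \<otimes> s j) \<otimes> (s i \<otimes> s j) [^] n"
      using closed by (simp add: m_assoc)
    then show ?case
      using closed nat_pow_Suc2 m_closed by simp
  qed simp
  have "?q = inv (s i \<otimes> s j)"
    using closed i j by (simp add: inv_mult_group inv_generator)
  then have "?q [^] ?n = inv ((s i \<otimes> s j) [^] ?n)"
    using closed by (metis nat_pow_inv m_closed)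
  then have q: "?q [^] ?n = \<one>"
    using relator_eq_one[OF i j m] by (simp add: pow)
  have shift: "?f (k + ?n) = ?f k" for k
    using closed q by (simp flip: nat_pow_mult)
  have "[0..<2 * ?n] = [0..<?n] @ map (\<lambda>k. k + ?n) [0..<?n]"
    using upt_add_eq_append[of 0 ?n ?n] by (simp add: mult_2 map_add_upt)
  then have "map ?f (rev [0..<2 * ?n])
      = map (\<lambda>k. ?f (k + ?n)) (rev [0..<?n]) @ map ?f (rev [0..<?n])"
    by (simp add: rev_map comp_def)
  then show thesis
    using that refls_alternating[OF i j, of ?n] unfolding shift by simp
qed

text \<open>
  Deleting a relator leaves the reflections of the other letters unchanged, as these are conjugated
  by products that include the whole relator or nothing of it. The reflections of the relator
  itself form a doubled list, whatever they are conjugated by.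
\<close>

lemma relator_step_parity:
  assumes "relator_step I m xs ys"
  shows "even (count_list (refls xs) t) \<longleftrightarrow> even (count_list (refls ys) t)"
  using assms
proof cases
  case (1 as bs i j)
  let ?R = "concat (replicate (m i j) [i, j])"
  let ?c = "\<lambda>t. inv (P bs) \<otimes> t \<otimes> P bs"
  have R: "?R \<in> lists I" using 1 by (simp only: alternating_word_closed)
  have prod: "P (?R @ bs) = P bs"
    using 1 R relator_eq_one[of i j] by (simp add: word_prod_append)
  obtain L where L: "refls ?R = L @ L"
    using refls_relator_doubled[of i j] 1 by blast
  have "refls xs = map ?c (refls as) @ refls (?R @ bs)"
    using refls_append[of as "?R @ bs"] 1 R prod by simp
  also have "refls (?R @ bs) = map ?c (L @ L) @ refls bs"
    using refls_append[of ?R bs] 1 R L by simp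
  finally show ?thesis
    using refls_append[of as bs] 1 by auto
qed

lemma refls_parity_well_defined:
  assumes "xs \<in> lists I" "ys \<in> lists I" "P xs = P ys"
  shows "even (count_list (refls xs) t) \<longleftrightarrow> even (count_list (refls ys) t)"
proof -
  have "equivclp (relator_step I m) xs ys"
    using presented assms by blast
  then show ?thesis
    by (induction rule: equivclp_induct) (auto simp: relator_step_parity)
qed

section \<open>Descents and exchange\<close>

text \<open>
  An odd count cannot be zero, and by the invariance of parity it is odd for a reduced word too;
  so \<open>t\<close> deletes a letter of a reduced word.
\<close>

lemma odd_refls_decreases:
  assumes "xs \<in> lists I" "odd (count_list (refls xs) t)"
  shows "len (P xs \<otimes> t) < len (P xs)"
proof -
  obtain ys where ys: "ys \<in> lists I" "P ys = P xs" "length ys = len (P xs)"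
    using reduced_word_exists[OF word_prod_closed[OF assms(1)]] .
  then have "odd (count_list (refls ys) t)"
    using assms refls_parity_well_defined by blast
  then have "t \<in> set (refls ys)"
    by (metis count_list_0_iff even_zero)
  then show ?thesis
    using mult_refl_deletes_letter[OF ys(1)] ys len_le by fastforce
qed

text \<open>
  Appending \<open>i\<close> conjugates the earlier reflections by \<open>s\<^sub>i\<close>, which fixes \<open>s\<^sub>i\<close>, and adds the
  reflection \<open>s\<^sub>i\<close>. So the parity at \<open>s\<^sub>i\<close> is flipped, and it is odd for \<open>w\<close> or for \<open>w s\<^sub>i\<close>.
\<close>

lemma odd_refls_snoc:
  assumes xs: "xs \<in> lists I" and i: "i \<in> I"
  shows "odd (count_list (refls (xs @ [i])) (s i)) \<longleftrightarrow> even (count_list (refls xs) (s i))"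
proof -
  have si: "s i \<in> carrier G" using i by (rule generators_closed)
  have fix_iff: "s i \<otimes> t \<otimes> s i = s i \<longleftrightarrow> t = s i" if "t \<in> carrier G" for t
  proof
    assume "s i \<otimes> t \<otimes> s i = s i"
    then have "s i \<otimes> t = s i \<otimes> s i"
      using that si i by (metis m_closed mult_generator_twice)
    then show "t = s i" using that si by simp
  qed (simp add: i si generator_square)
  have "count_list (map (\<lambda>t. s i \<otimes> t \<otimes> s i) ts) (s i) = count_list ts (s i)"
    if "set ts \<subseteq> carrier G" for ts
    using that by (induction ts) (auto simp: fix_iff)
  moreover have "refls (xs @ [i]) = map (\<lambda>t. s i \<otimes> t \<otimes> s i) (refls xs) @ [s i]"
    using refls_append[OF xs, of "[i]"] i si by (simp add: inv_generator)
  ultimately show ?thesis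
    using refls_closed[OF xs] by simp
qed

lemma descent_iff_odd_refls:
  assumes xs: "xs \<in> lists I" and i: "i \<in> I"
  shows "i \<in> right_descents G I s (P xs) \<longleftrightarrow> odd (count_list (refls xs) (s i))"
    and "i \<notin> right_descents G I s (P xs) \<longleftrightarrow> len (P xs) < len (P xs \<otimes> s i)"
proof -
  have snoc: "xs @ [i] \<in> lists I" "P (xs @ [i]) = P xs \<otimes> s i"
    using xs i by (auto simp: word_prod_append generators_closed)
  have "len (P xs) < len (P xs \<otimes> s i)" if "even (count_list (refls xs) (s i))"
    using odd_refls_decreases[OF snoc(1), of "s i"] odd_refls_snoc[OF xs i] that snoc(2) xs i
    by (simp add: mult_generator_twice)
  moreover have "len (P xs \<otimes> s i) < len (P xs)" if "odd (count_list (refls xs) (s i))"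
    using odd_refls_decreases[OF xs that] .
  ultimately show
    "i \<in> right_descents G I s (P xs) \<longleftrightarrow> odd (count_list (refls xs) (s i))"
    "i \<notin> right_descents G I s (P xs) \<longleftrightarrow> len (P xs) < len (P xs \<otimes> s i)"
    using i unfolding right_descents_def by (force dest: less_asym)+
qed

lemma len_mult_generator:
  assumes w: "w \<in> carrier G" and i: "i \<in> I"
  shows "i \<in> right_descents G I s w \<Longrightarrow> len w = Suc (len (w \<otimes> s i))"
    and "i \<notin> right_descents G I s w \<Longrightarrow> len (w \<otimes> s i) = Suc (len w)"
proof -
  have si: "s i \<in> carrier G" using i by (rule generators_closed)
  have up: "len (w \<otimes> s i) \<le> Suc (len w)"
    using len_mult_le[OF w si] len_generator_le[OF i] by simp
  have down: "len w \<le> Suc (len (w \<otimes> s i))"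
    using len_mult_le[of "w \<otimes> s i" "s i"] len_generator_le[OF i] w si i
    by (simp add: mult_generator_twice)
  show "len w = Suc (len (w \<otimes> s i))" if "i \<in> right_descents G I s w"
    using that down unfolding right_descents_def by simp
  obtain xs where "xs \<in> lists I" "P xs = w"
    using generated[OF w] by blast
  then show "len (w \<otimes> s i) = Suc (len w)" if "i \<notin> right_descents G I s w"
    using descent_iff_odd_refls(2)[of xs i] i that up by simp
qed

text \<open>
  The parity at \<open>s\<^sub>i\<close> is odd for \<open>x u\<close> and even for \<open>u\<close>. So \<open>s\<^sub>i\<close> is among the reflections
  \<open>u\<^sup>-\<^sup>1 t u\<close> that come from the letters of \<open>x\<close>, and the deleted letter lies in \<open>x\<close>.
\<close>

lemma exchange_left_factor:
  assumes x: "x \<in> carrier G" and u: "u \<in> carrier G" and i: "i \<in> I"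
    and desc: "i \<in> right_descents G I s (x \<otimes> u)" "i \<notin> right_descents G I s u"
  obtains x' where "x' \<in> carrier G" "x \<otimes> u \<otimes> s i = x' \<otimes> u" "len x' < len x"
proof -
  obtain xs where xs: "xs \<in> lists I" "P xs = x" "length xs = len x"
    using reduced_word_exists[OF x] .
  obtain ys where ys: "ys \<in> lists I" "P ys = u"
    using generated[OF u] by blast
  let ?c = "\<lambda>t. inv u \<otimes> t \<otimes> u"
  have "odd (count_list (refls (xs @ ys)) (s i))"
    using descent_iff_odd_refls(1)[of "xs @ ys" i] xs ys i desc by (simp add: word_prod_append)
  moreover have "even (count_list (refls ys) (s i))"
    using descent_iff_odd_refls(1)[of ys i] ys i desc by simp
  ultimately have "odd (count_list (map ?c (refls xs)) (s i))"
    using refls_append[OF xs(1) ys(1)] ys(2) by simp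
  then have "s i \<in> set (map ?c (refls xs))"
    by (metis count_list_0_iff even_zero)
  then obtain t where t: "t \<in> set (refls xs)" "s i = ?c t"
    by auto
  have t_closed: "t \<in> carrier G"
    using t(1) refls_closed[OF xs(1)] by blast
  obtain zs where zs: "zs \<in> lists I" "length zs < length xs" "x \<otimes> t = P zs"
    using mult_refl_deletes_letter[OF xs(1) t(1)] xs(2) by auto
  have "x \<otimes> u \<otimes> s i = x \<otimes> (u \<otimes> inv u) \<otimes> t \<otimes> u"
    unfolding t(2) using x u t_closed by (simp add: m_assoc mult_inv_mult)
  also have "\<dots> = P zs \<otimes> u"
    using x u t_closed zs(3) by simp
  finally show thesis
    using that[of "P zs"] zs xs(3) len_le[OF zs(1)] by simp
qed

section \<open>The biHecke action on left order\<close>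

lemma left_order_mult_generator_both:
  assumes w: "u \<in> carrier G" "v \<in> carrier G" and i: "i \<in> I"
    and le: "left_order G I s u v"
    and desc: "i \<in> right_descents G I s u \<longleftrightarrow> i \<in> right_descents G I s v"
  shows "left_order G I s (u \<otimes> s i) (v \<otimes> s i)"
proof -
  have si: "s i \<in> carrier G" using i by (rule generators_closed)
  obtain x where x: "x \<in> carrier G" "v = x \<otimes> u" "len v = len x + len u"
    using le left_order_iff_length_add[OF w] by blast
  have "v \<otimes> s i = x \<otimes> (u \<otimes> s i)"
    using x w si by (simp add: m_assoc)
  moreover have "len (v \<otimes> s i) = len x + len (u \<otimes> s i)"
    using len_mult_generator[OF w(1) i] len_mult_generator[OF w(2) i] desc x(3)
    by (cases "i \<in> right_descents G I s u") auto
  ultimately show ?thesis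
    using left_order_iff_length_add[of "u \<otimes> s i" "v \<otimes> s i"] w si x(1) by auto
qed

lemma left_order_descent_mono:
  assumes w: "u \<in> carrier G" "v \<in> carrier G" and i: "i \<in> I"
    and le: "left_order G I s u v" and desc: "i \<in> right_descents G I s u"
  shows "i \<in> right_descents G I s v"
proof -
  have si: "s i \<in> carrier G" using i by (rule generators_closed)
  obtain x where x: "x \<in> carrier G" "v = x \<otimes> u" "len v = len x + len u"
    using le left_order_iff_length_add[OF w] by blast
  have "len (v \<otimes> s i) \<le> len x + len (u \<otimes> s i)"
    using len_mult_le[of x "u \<otimes> s i"] x w si by (simp add: m_assoc)
  also have "\<dots> < len v"
    using desc x(3) unfolding right_descents_def by simp
  finally show ?thesis
    using i unfolding right_descents_def by simp
qed

lemma left_order_mult_generator_one: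
  assumes w: "u \<in> carrier G" "v \<in> carrier G" and i: "i \<in> I"
    and le: "left_order G I s u v"
    and desc: "i \<notin> right_descents G I s u" "i \<in> right_descents G I s v"
  shows "left_order G I s u (v \<otimes> s i)" and "left_order G I s (u \<otimes> s i) v"
proof -
  have si: "s i \<in> carrier G" using i by (rule generators_closed)
  obtain x where x: "x \<in> carrier G" "v = x \<otimes> u" "len v = len x + len u"
    using le left_order_iff_length_add[OF w] by blast
  obtain x' where x': "x' \<in> carrier G" "v \<otimes> s i = x' \<otimes> u" "len x' < len x"
    using exchange_left_factor[OF x(1) w(1) i] desc x(2) by metis
  have len_v: "len v = Suc (len (v \<otimes> s i))"
    using len_mult_generator(1)[OF w(2) i] desc by simp
  have len_u: "len (u \<otimes> s i) = Suc (len u)"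
    using len_mult_generator(2)[OF w(1) i] desc by simp
  have len_vs: "len (v \<otimes> s i) = len x' + len u"
    using len_mult_le[OF x'(1) w(1)] x'(2,3) x(3) len_v by simp
  then show "left_order G I s u (v \<otimes> s i)"
    using left_order_iff_length_add[of u "v \<otimes> s i"] w si x' by auto
  have "v = x' \<otimes> (u \<otimes> s i)"
    using x' w si i by (metis m_assoc mult_generator_twice)
  moreover have "len v = len x' + len (u \<otimes> s i)"
    using len_v len_vs len_u by simp
  ultimately show "left_order G I s (u \<otimes> s i) v"
    using left_order_iff_length_add[of "u \<otimes> s i" v] w si x'(1) by auto
qed

lemma hecke_pi_left_order:
  assumes "u \<in> carrier G" "v \<in> carrier G" "i \<in> I" "left_order G I s u v"
  shows "left_order G I s (hecke_pi G I s i u) (hecke_pi G I s i v)"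
proof -
  have "i \<in> right_descents G I s u \<longrightarrow> i \<in> right_descents G I s v"
    using left_order_descent_mono[OF assms] by blast
  then show ?thesis
    using assms(1,2,4) left_order_mult_generator_both[OF assms]
      left_order_mult_generator_one(2)[OF assms]
    unfolding hecke_pi_def by (simp split: if_split)
qed

lemma hecke_pi_bar_left_order:
  assumes "u \<in> carrier G" "v \<in> carrier G" "i \<in> I" "left_order G I s u v"
  shows "left_order G I s (hecke_pi_bar G I s i u) (hecke_pi_bar G I s i v)"
proof -
  have "i \<in> right_descents G I s u \<longrightarrow> i \<in> right_descents G I s v"
    using left_order_descent_mono[OF assms] by blast
  then show ?thesis
    using assms(1,2,4) left_order_mult_generator_both[OF assms]
      left_order_mult_generator_one(1)[OF assms]
    unfolding hecke_pi_bar_def by (simp split: if_split)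
qed

lemma biHecke_monoid_closed:
  "f \<in> biHecke_monoid G I s \<Longrightarrow> w \<in> carrier G \<Longrightarrow> f w \<in> carrier G"
  by (induction arbitrary: w rule: biHecke_monoid.induct)
    (auto simp: hecke_pi_def hecke_pi_bar_def compose_def generators_closed)

lemma biHecke_monoid_left_order:
  assumes "f \<in> biHecke_monoid G I s" "u \<in> carrier G" "v \<in> carrier G" "left_order G I s u v"
  shows "left_order G I s (f u) (f v)"
  using assms
  by (induction arbitrary: u v rule: biHecke_monoid.induct)
    (auto simp: hecke_pi_left_order hecke_pi_bar_left_order compose_def biHecke_monoid_closed)

end

theorem proposition3p2:
  fixes W :: "('a, 'b) monoid_scheme" and I :: "'i set" and s :: "'i \<Rightarrow> 'a"
    and m :: "'i \<Rightarrow> 'i \<Rightarrow> nat" and f :: "'a \<Rightarrow> 'a" and u v :: 'a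
  assumes "coxeter_system W I s m"
    and "finite (carrier W)"
    and "f \<in> biHecke_monoid W I s"
    and "u \<in> carrier W" and "v \<in> carrier W"
    and "left_order W I s u v"
  shows "left_order W I s (f u) (f v)"
  using assms(1,3-6) by (rule coxeter_system.biHecke_monoid_left_order)

end
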